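(* For every integer $n\ge 1$, the map $\phi: T\mapsto B=\phi(T)$ defined by the algorithm described in the context is a bijection from the set of Catalan tableaux of index $n$ onto the set of binary trees with $n$ vertices.
   Context: **Catalan tableaux.** A Ferrers diagram $F_\lambda$ of a partition $\lambda=(\lambda_1\ge\lambda_2\ge\cdots\ge\lambda_k\ge 0)$ is drawn right-justified with rows written from bottom to top: the $i$-th row from the bottom has $\lambda_i$ cells (zero rows are allowed). It is placed inside a $k\times(n-k)$ rectangle ($k$ rows, $n-k$ columns), in the bottom-right corner. A Catalan tableau of index $n$ consists of some $k$ with $0\le k\le n$, a diagram $F_\lambda$ contained in the $k\times(n-k)$ rectangle, and a filling of the cells of $F_\lambda$ with $0$'s and $1$'s such that (i) each of the $n-k$ columns of the rectangle contains exactly one $1$; (ii) there is no $0$ which has both a $1$ below it in the same column and a $1$ to its right in the same row. The North-West border of the tableau, read from the South-West corner to the North-East corner of the rectangle, is a word of $n$ unit steps N (north) and E (east). For $n\ge1$ its first step is N, because every column is non-empty. **Binary trees.** A binary tree is either empty or a triple $(L,r,R)$ with root $r$ and left and right subtrees $L,R$, which are binary trees. The left (right) son of a vertex is the root of its left (right) subtree, if non-empty. The right branch of a binary tree is the sequence of vertices obtained from the root by repeatedly passing to the right son. A right chain is a binary tree all of whose vertices lie on its right branch. **Algorithm defining $\phi$.** Let $T$ be a Catalan tableau of index $n\ge 1$ and let $\omega$ be its North-West border (a word of length $n$ in N, E). (a) If $\omega$ contains no E, then $\phi(T)$ is the right chain with $n$ vertices. (b) Otherwise write $\omega=\mathrm{N}^m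 v$ with $v$ beginning with E. Start with the current tableau $T$, with $B$ the right chain with vertices $s_0,s_1,\dots,s_m$ ($s_0$ the root, $s_{i+1}$ the right son of $s_i$), and with the word $v$ (the tail) attached at the vertex $s_m$. In general one has a current tableau, a binary tree $B$ with right branch $s_0,s_1,s_2,\dots$, and a tail $v$ (a word in N, E which is empty or begins with E) attached at a vertex $s_r$ of the right branch; the North-West border of the current tableau is the word $\mathrm{N}^r v$. While $v$ is non-empty, consider the corner cell $c$, the top cell of the leftmost column of the current tableau, and do the following. (c) If $c$ contains $0$: delete the row containing $c$ from the current tableau, keep $B$ and the word $v$, and attach $v$ at $s_{r-1}$ instead of $s_r$. (d) If $c$ contains $1$: delete the column containing $c$ from the current tableau. Write $v=\mathrm{E}\,\mathrm{N}^q\,v'$ with $q\ge 0$ and $v'$ empty or beginning with E. Replace in $B$ the subtree $B_{s_r}$ rooted at $s_r$ by the binary tree with new root $t_1$, left subtree $B_{s_r}$, and right subtree the right chain with $q$ new vertices $t_2,\dots,t_{q+1}$. The new tail is $v'$, attached at $t_{q+1}$, the last vertex of the right branch of the new tree; relabel the right branch as $s_0,s_1,\dots$. (e) When the tail is empty, $B$ has $n+1$ vertices and its root has an empty left subtree; $\phi(T)$ is the binary tree obtained from $B$ by deleting the root and the right edge starting from it, i.e. the right subtree of the root of $B$. *)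

theory Defs
  imports "HOL-Library.Tree" "HOL-Library.While_Combinator"
begin

section \<open>Catalan tableaux\<close>

text \<open>
  A tableau in a $k \times w$ rectangle is given by the width $w$ of the rectangle and the list
  of the $k$ rows of the filled Ferrers diagram, from bottom to top. As the diagram sits in the
  bottom-right corner, each row lists its entries from right to left: in the coordinates
  $(i, j)$, starting from 0, row $i$ is counted from the bottom and column $j$ from the right.
  The partition is the list of the row lengths (empty rows are allowed), and the entry 1 is
  represented by \<^term>\<open>True\<close>, the entry 0 by \<^term>\<open>False\<close>.
\<close>

datatype tableau = Tableau (width: nat) (rows: "bool list list")

definition shape :: "tableau \<Rightarrow> nat list" where
  "shape T = map length (rows T)"

definition cells :: "tableau \<Rightarrow> (nat \<times> nat) set" where
  "cells T = {(i, j). i < length (rows T) \<and> j < length (rows T ! i)}"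

definition has_one :: "tableau \<Rightarrow> nat \<Rightarrow> nat \<Rightarrow> bool" where
  "has_one T i j \<longleftrightarrow> (i, j) \<in> cells T \<and> rows T ! i ! j"

definition has_zero :: "tableau \<Rightarrow> nat \<Rightarrow> nat \<Rightarrow> bool" where
  "has_zero T i j \<longleftrightarrow> (i, j) \<in> cells T \<and> \<not> rows T ! i ! j"

definition tableau_index :: "tableau \<Rightarrow> nat" where
  "tableau_index T = length (rows T) + width T"

definition catalan_tableaux :: "nat \<Rightarrow> tableau set" where
  "catalan_tableaux n = {T.
     tableau_index T = n \<and>
     sorted_wrt (\<ge>) (shape T) \<and> (\<forall>l\<in>set (shape T). l \<le> width T) \<and>
     (\<forall>j<width T. \<exists>!i. has_one T i j) \<and>
     \<not> (\<exists>i j. has_zero T i j \<and> (\<exists>i'<i. has_one T i' j) \<and> (\<exists>j'<j. has_one T i j'))}"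

datatype step = North | East

text \<open>
  The border of a diagram in a rectangle of width $w$, starting on the left side of the
  rectangle: level with each row it has moved east up to that row's leftmost cell, and after the
  last row it moves east to the right side of the rectangle.
\<close>

fun border_word :: "nat \<Rightarrow> nat list \<Rightarrow> step list" where
  "border_word w [] = replicate w East"
| "border_word w (l # ls) = replicate (w - l) East @ North # border_word l ls"

definition nw_border :: "tableau \<Rightarrow> step list" where
  "nw_border T = border_word (width T) (shape T)"

definition delete_row :: "nat \<Rightarrow> tableau \<Rightarrow> tableau" where
  "delete_row i T = Tableau (width T) (take i (rows T) @ drop (Suc i) (rows T))"

definition delete_leftmost_column :: "tableau \<Rightarrow> tableau" where
  "delete_leftmost_column T =
     Tableau (width T - 1) (map (take (width T - 1)) (rows T))"

text \<open>The row of the corner cell, i.e. of the top cell of the leftmost column.\<close>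

definition corner_row :: "tableau \<Rightarrow> nat" where
  "corner_row T = Max {i. (i, width T - 1) \<in> cells T}"

definition corner_is_one :: "tableau \<Rightarrow> bool" where
  "corner_is_one T \<longleftrightarrow> has_one T (corner_row T) (width T - 1)"

section \<open>Binary trees\<close>

type_synonym btree = "unit tree"

fun right_chain :: "nat \<Rightarrow> btree" where
  "right_chain 0 = Leaf"
| "right_chain (Suc q) = Node Leaf () (right_chain q)"

text \<open>
  Apply $f$ to the subtree whose root is the vertex $s_r$ of the right branch
  $s_0, s_1, \dots$ of a binary tree.
\<close>

fun map_right_subtree :: "nat \<Rightarrow> (btree \<Rightarrow> btree) \<Rightarrow> btree \<Rightarrow> btree" where
  "map_right_subtree 0 f B = f B"
| "map_right_subtree (Suc r) f Leaf = Leaf"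
| "map_right_subtree (Suc r) f (Node L x R) = Node L x (map_right_subtree r f R)"

section \<open>The map from Catalan tableaux to binary trees\<close>

text \<open>
  A state $(T, B, v, r)$ consists of the current tableau, the current tree, the tail $v$, and
  the position $r$ of the vertex $s_r$ on the right branch of $B$ to which $v$ is attached.
  When the corner contains a 1, the last vertex $t_{q+1}$ of the new right branch
  $s_0, \dots, s_{r-1}, t_1, \dots, t_{q+1}$ has position $r + q$.
\<close>

type_synonym state = "tableau \<times> btree \<times> step list \<times> nat"

fun phi_step :: "state \<Rightarrow> state" where
  "phi_step (T, B, v, r) =
     (if corner_is_one T then
        let q = length (takeWhile (\<lambda>s. s = North) (tl v));
            v' = dropWhile (\<lambda>s. s = North) (tl v)
        in (delete_leftmost_column T,
            map_right_subtree r (\<lambda>S. Node S () (right_chain q)) B, v', r + q)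
      else (delete_row (corner_row T) T, B, v, r - 1))"

definition phi_init :: "tableau \<Rightarrow> state" where
  "phi_init T =
     (let m = length (takeWhile (\<lambda>s. s = North) (nw_border T));
          v = dropWhile (\<lambda>s. s = North) (nw_border T)
      in (T, right_chain (Suc m), v, m))"

definition phi :: "tableau \<Rightarrow> btree" where
  "phi T =
     (if East \<notin> set (nw_border T) then right_chain (tableau_index T)
      else case while (\<lambda>(T, B, v, r). v \<noteq> []) phi_step (phi_init T) of
        (T', B, v, r) \<Rightarrow> right B)"

end

theory Submission
  imports Defs
begin

text \<open>
  The algorithm is a reversible machine. On its set of reachable configurations, the step map is
  a bijection from the configurations that are not final onto those that are not initial, and
  every step shortens the tableau, whose index is at most \<open>n\<close>. A loop with these two properties is automatically a bijection
  from initial to final configurations, because running the inverse steps undoes it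
  (\<open>while_bij_betw\<close>). Initial configurations correspond to Catalan tableaux
  (\<open>bij_betw_phi_init\<close>) and final ones to binary trees (\<open>bij_betw_final_tree\<close>), so
  everything rests on the reversibility of one step (\<open>bij_betw_phi_step\<close>).

  On the side of tableaux, reversibility holds because the corner of a Catalan tableau determines
  its surroundings. If the corner contains 0, its column has its only 1 below the corner, so the
  row of the corner consists of zeros. If it contains 1, the rest of its column consists of zeros.
  Conversely, a full row of zeros placed on top of the full rows, or a new leftmost column whose cells lie in the full rows and whose single 1 is on top, always preserves the Catalan property
  (\<open>is_catalan_cases\<close>, \<open>is_catalan_insert_zero_row\<close>, \<open>is_catalan_insert_column\<close>).

  On the side of trees, write a tree as the list of the left subtrees along its right branch. After
  a column has been deleted, the tail is attached to the last vertex of the right branch, and the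
  last vertex having a non-empty left subtree is the newly inserted one; after a row has been
  deleted, the tail is attached strictly above the last vertex. Hence the tree together with the
  position of the tail reveals whether there was a previous step, and which one. If a column was
  deleted, it also shows where: the non-empty left subtree is the subtree that was displaced, and
  the vertices below it on the right branch count the rows that became full. If the tail is attached
  to the last vertex and all left subtrees are empty, the tree is a right chain and the
  configuration is initial.
\<close>

section \<open>Loops of injective steps\<close>

text \<open>
  The premises are asymmetric on purpose: applied to the forward loop and again with the roles of
  \<open>f\<close> and \<open>g\<close> exchanged, the lemma yields both halves of the bijection. Started after the
  forward loop, the backward loop first retraces its steps, each of which lands where \<open>c\<close> holds,
  and then continues as if it had been started at \<open>s\<close>.
\<close>

lemma while_absorbs_inverse_loop:
  fixes \<mu> :: "'s \<Rightarrow> nat"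
  assumes "s \<in> S"
    and step: "\<And>s. s \<in> S \<Longrightarrow> b s \<Longrightarrow> f s \<in> S \<and> c (f s) \<and> g (f s) = s \<and> \<mu> (f s) < \<mu> s"
  shows "while b f s \<in> {s \<in> S. \<not> b s} \<and> while c g (while b f s) = while c g s"
  using assms(1)
proof (induction "\<mu> s" arbitrary: s rule: less_induct)
  case less
  show ?case
  proof (cases "b s")
    case True
    then have "while b f s = while b f (f s)"
      by (simp add: while_unfold)
    moreover have "while c g (f s) = while c g s"
      using step[OF less.prems True] by (simp add: while_unfold[of c g "f s"])
    ultimately show ?thesis
      using less.hyps[of "f s"] step[OF less.prems True] by simp
  next
    case False
    then show ?thesis
      using less.prems by (simp add: while_unfold)
  qed
qed

text \<open>
  If \<open>c\<close> fails at the starting point, the backward loop stops exactly there, so the two loops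
  are mutually inverse. The bound \<open>N\<close> makes the backward loop terminate: the measure, which
  decreases along the forward loop, increases along the backward one.
\<close>

lemma while_bij_betw:
  fixes \<mu> :: "'s \<Rightarrow> nat"
  assumes bij: "bij_betw f {s \<in> S. b s} {s \<in> S. c s}"
    and decr: "\<And>s. s \<in> S \<Longrightarrow> b s \<Longrightarrow> \<mu> (f s) < \<mu> s"
    and bound: "\<And>s. s \<in> S \<Longrightarrow> \<mu> s \<le> N"
  shows "bij_betw (while b f) {s \<in> S. \<not> c s} {s \<in> S. \<not> b s}"
proof -
  define g where "g = inv_into {s \<in> S. b s} f"
  have fwd: "f s \<in> S \<and> c (f s) \<and> g (f s) = s \<and> \<mu> (f s) < \<mu> s" if "s \<in> S" "b s" for s
    using that bij_betwE[OF bij] bij_betw_inv_into_left[OF bij, of s] decr[of s]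
    by (auto simp: g_def)
  have bwd: "g s \<in> S \<and> b (g s) \<and> f (g s) = s \<and> N - \<mu> (g s) < N - \<mu> s" if "s \<in> S" "c s" for s
  proof -
    have 1: "g s \<in> S" "b (g s)" "f (g s) = s"
      using that bij_betwE[OF bij_betw_inv_into[OF bij]] bij_betw_inv_into_right[OF bij, of s]
      by (auto simp: g_def)
    then show ?thesis
      using decr[of "g s"] bound[of "g s"] by simp
  qed
  have stop: "while p h s = s" if "\<not> p s" for p and h :: "'s \<Rightarrow> 's" and s
    using that by (simp add: while_unfold)
  show ?thesis
    using while_absorbs_inverse_loop[of _ S b f c g \<mu>, OF _ fwd]
      while_absorbs_inverse_loop[of _ S c g b f "\<lambda>s. N - \<mu> s", OF _ bwd]
    by (intro bij_betw_byWitness[where f' = "while c g"]) (auto simp: stop)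
qed

section \<open>Catalan tableaux\<close>

definition is_catalan :: "tableau \<Rightarrow> bool" where
  "is_catalan T \<longleftrightarrow> T \<in> catalan_tableaux (tableau_index T)"

lemma mem_catalan_tableaux_iff:
  "T \<in> catalan_tableaux n \<longleftrightarrow> is_catalan T \<and> tableau_index T = n"
  by (auto simp: is_catalan_def catalan_tableaux_def)

lemma has_one_Tableau:
  "has_one (Tableau w rs) i j \<longleftrightarrow> i < length rs \<and> j < length (rs ! i) \<and> rs ! i ! j"
  by (auto simp: has_one_def cells_def)

lemma has_zero_Tableau:
  "has_zero (Tableau w rs) i j \<longleftrightarrow> i < length rs \<and> j < length (rs ! i) \<and> \<not> rs ! i ! j"
  by (auto simp: has_zero_def cells_def)

lemma is_catalan_Tableau:
  "is_catalan (Tableau w rs) \<longleftrightarrow>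
     sorted_wrt (\<ge>) (map length rs) \<and> (\<forall>x\<in>set rs. length x \<le> w) \<and>
     (\<forall>j<w. \<exists>!i. has_one (Tableau w rs) i j) \<and>
     (\<forall>i j i' j'. has_zero (Tableau w rs) i j \<longrightarrow> i' < i \<longrightarrow> has_one (Tableau w rs) i' j \<longrightarrow>
        j' < j \<longrightarrow> \<not> has_one (Tableau w rs) i j')"
proof -
  have "\<not> (\<exists>i j. Z i j \<and> (\<exists>i'<i. P i' j) \<and> (\<exists>j'<j. P i j')) \<longleftrightarrow>
      (\<forall>i j i' j'. Z i j \<longrightarrow> i' < i \<longrightarrow> P i' j \<longrightarrow> j' < j \<longrightarrow> \<not> P i j')"
    for Z P :: "nat \<Rightarrow> nat \<Rightarrow> bool"
    by blast
  then show ?thesis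
    by (simp add: is_catalan_def catalan_tableaux_def shape_def)
qed

text \<open>
  A row of zeros contributes no 1 to any column, and its zeros have no 1 to their right. The
  map \<open>sk\<close> below renumbers the remaining rows; it preserves their order, so that the conditions on
  columns and on zeros transfer.
\<close>

lemma is_catalan_insert_zero_row:
  assumes xs: "\<forall>x\<in>set xs. length x = w" and ys: "\<forall>y\<in>set ys. length y \<le> w"
  shows "is_catalan (Tableau w (xs @ replicate w False # ys)) \<longleftrightarrow> is_catalan (Tableau w (xs @ ys))"
    (is "is_catalan ?T \<longleftrightarrow> is_catalan ?T'")
proof -
  let ?r = "length xs"
  define sk where "sk i = (if i < ?r then i else Suc i)" for i
  have one: "has_one ?T (sk i) j = has_one ?T' i j" for i j
    by (auto simp: has_one_Tableau sk_def nth_append)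
  have zero: "has_zero ?T (sk i) j = has_zero ?T' i j" for i j
    by (auto simp: has_zero_Tableau sk_def nth_append)
  have no_one: "\<not> has_one ?T ?r j" for j
    by (auto simp: has_one_Tableau nth_append)
  have mono: "sk i < sk i' \<longleftrightarrow> i < i'" for i i'
    by (auto simp: sk_def)
  have inj: "sk i = sk i' \<longleftrightarrow> i = i'" for i i'
    by (auto simp: sk_def split: if_splits)
  have sk: "\<exists>k. i = sk k" if "i \<noteq> ?r" for i
    using that by (intro exI[of _ "if i < ?r then i else i - 1"]) (auto simp: sk_def)
  have columns: "(\<exists>!i. has_one ?T i j) \<longleftrightarrow> (\<exists>!i. has_one ?T' i j)" for j
  proof
    assume "\<exists>!i. has_one ?T i j"
    then obtain i where i: "has_one ?T i j" "\<And>i'. has_one ?T i' j \<Longrightarrow> i' = i"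
      by blast
    then have "i \<noteq> ?r"
      using i(1) no_one[of j] by metis
    then obtain k where k: "i = sk k"
      using sk by blast
    show "\<exists>!i. has_one ?T' i j"
    proof (rule ex1I[of _ k])
      show "has_one ?T' k j"
        using i(1) k one by simp
      show "k' = k" if "has_one ?T' k' j" for k'
        using i(2)[of "sk k'"] that k one inj by simp
    qed
  next
    assume "\<exists>!i. has_one ?T' i j"
    then obtain k where k: "has_one ?T' k j" "\<And>k'. has_one ?T' k' j \<Longrightarrow> k' = k"
      by blast
    show "\<exists>!i. has_one ?T i j"
    proof (rule ex1I[of _ "sk k"])
      show "has_one ?T (sk k) j"
        using k(1) one by simp
      show "i = sk k" if "has_one ?T i j" for i
      proof -
        have "i \<noteq> ?r"
          using that no_one[of j] by metis
        then obtain k' where "i = sk k'"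
          using sk by blast
        then show ?thesis
          using that one k(2)[of k'] by simp
      qed
    qed
  qed
  have zeros: "(\<forall>i j i' j'. has_zero ?T i j \<longrightarrow> i' < i \<longrightarrow> has_one ?T i' j \<longrightarrow> j' < j \<longrightarrow>
      \<not> has_one ?T i j') \<longleftrightarrow>
    (\<forall>i j i' j'. has_zero ?T' i j \<longrightarrow> i' < i \<longrightarrow> has_one ?T' i' j \<longrightarrow> j' < j \<longrightarrow>
      \<not> has_one ?T' i j')" (is "?L \<longleftrightarrow> ?R")
  proof
    assume ?L
    show ?R
    proof (intro allI impI)
      fix i j i' j'
      assume "has_zero ?T' i j" "i' < i" "has_one ?T' i' j" "j' < j"
      then show "\<not> has_one ?T' i j'"
        using \<open>?L\<close>[rule_format, of "sk i" j "sk i'" j'] by (simp add: one zero mono)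
    qed
  next
    assume ?R
    show ?L
    proof (intro allI impI)
      fix i j i' j'
      assume *: "has_zero ?T i j" "i' < i" "has_one ?T i' j" "j' < j"
      show "\<not> has_one ?T i j'"
      proof (cases "i = ?r")
        case True
        then show ?thesis using no_one[of j'] by metis
      next
        case False
        then obtain k where k: "i = sk k"
          using sk by blast
        have "i' \<noteq> ?r"
          using *(3) no_one[of j] by metis
        then obtain k' where k': "i' = sk k'"
          using sk by blast
        show ?thesis
          using \<open>?R\<close>[rule_format, of k j k' j'] * by (simp add: k k' one zero mono)
      qed
    qed
  qed
  have sorted: "sorted_wrt (\<ge>) (map length (xs @ replicate w False # ys)) \<longleftrightarrow>
      sorted_wrt (\<ge>) (map length (xs @ ys))"
    using xs ys by (auto simp: sorted_wrt_append)
  show ?thesis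
    unfolding is_catalan_Tableau columns zeros sorted by auto
qed

text \<open>
  The new entries are harmless for the condition on zeros: each new 0 lies below the only 1 of its
  column, and the new 1, in the leftmost column, is to the right of no other cell.
\<close>

lemma is_catalan_insert_column:
  assumes xs: "\<forall>y\<in>set xs. length y = w" and x: "length x = w"
    and ys: "\<forall>y\<in>set ys. length y \<le> w"
  shows "is_catalan (Tableau (Suc w) (map (\<lambda>y. y @ [False]) xs @ (x @ [True]) # ys)) \<longleftrightarrow>
    is_catalan (Tableau w (xs @ x # ys))"
    (is "is_catalan ?T \<longleftrightarrow> is_catalan ?T'")
proof -
  let ?r = "length xs"
  let ?rs = "map (\<lambda>y. y @ [False]) xs @ (x @ [True]) # ys" and ?rs' = "xs @ x # ys"
  obtain R R' where R: "R = ?rs" "R' = ?rs'"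
    by blast
  have length_R: "length R = length R'" and r: "?r < length R'"
    by (simp_all add: R)
  have row: "R ! i = (if i < ?r then R' ! i @ [False] else if i = ?r then R' ! i @ [True]
      else R' ! i)" if "i < length R'" for i
    using that by (auto simp: R nth_append nth_Cons')
  have len: "length (R' ! i) = w" if "i \<le> ?r" for i
    using that xs x by (auto simp: R nth_append le_less)
  have le: "length (R' ! i) \<le> w" if "i < length R'" for i
  proof -
    have "R' ! i \<in> set R'"
      using that by simp
    then show ?thesis
      using xs x ys by (auto simp: R(2) simp del: nth_mem)
  qed
  have one: "has_one ?T i j \<longleftrightarrow> has_one ?T' i j \<or> i = ?r \<and> j = w" for i j
    unfolding R[symmetric] has_one_Tableau length_R
    using row[of i] len[of i] le[of i] r
    by (cases "i < ?r"; cases "i = ?r") (auto simp: nth_append less_Suc_eq)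
  have zero: "has_zero ?T i j \<longleftrightarrow> has_zero ?T' i j \<or> i < ?r \<and> j = w" for i j
    unfolding R[symmetric] has_zero_Tableau length_R
    using row[of i] len[of i] le[of i] r
    by (cases "i < ?r"; cases "i = ?r") (auto simp: nth_append less_Suc_eq)
  have one_lt: "j < w" if "has_one ?T' i j" for i j
    using that le[of i] unfolding R[symmetric] has_one_Tableau by auto
  have zero_lt: "j < w" if "has_zero ?T' i j" for i j
    using that le[of i] unfolding R[symmetric] has_zero_Tableau by auto
  have old_columns: "(\<exists>!i. has_one ?T i j) \<longleftrightarrow> (\<exists>!i. has_one ?T' i j)" if "j < w" for j
    using that by (simp add: one)
  have new_column: "\<exists>!i. has_one ?T i w"
    using one_lt[of _ w] by (auto simp: one)
  have columns:
    "(\<forall>j<Suc w. \<exists>!i. has_one ?T i j) \<longleftrightarrow> (\<forall>j<w. \<exists>!i. has_one ?T' i j)"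
    (is "?L \<longleftrightarrow> ?R")
  proof
    assume ?L
    show ?R
    proof (intro allI impI)
      fix j
      assume "j < w"
      then show "\<exists>!i. has_one ?T' i j"
        using \<open>?L\<close>[rule_format, of j] old_columns[of j] by simp
    qed
  next
    assume ?R
    show ?L
    proof (intro allI impI)
      fix j
      assume "j < Suc w"
      then show "\<exists>!i. has_one ?T i j"
        using \<open>?R\<close>[rule_format, of j] old_columns[of j] new_column
        by (cases "j = w") simp_all
    qed
  qed
  have zeros: "(\<forall>i j i' j'. has_zero ?T i j \<longrightarrow> i' < i \<longrightarrow> has_one ?T i' j \<longrightarrow> j' < j \<longrightarrow>
      \<not> has_one ?T i j') \<longleftrightarrow>
    (\<forall>i j i' j'. has_zero ?T' i j \<longrightarrow> i' < i \<longrightarrow> has_one ?T' i' j \<longrightarrow> j' < j \<longrightarrow>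
      \<not> has_one ?T' i j')" (is "?L \<longleftrightarrow> ?R")
  proof
    assume ?L
    then show ?R
      by (simp add: one zero)
  next
    assume ?R
    show ?L
    proof (intro allI impI)
      fix i j i' j'
      assume *: "has_zero ?T i j" "i' < i" "has_one ?T i' j" "j' < j"
      then have "has_zero ?T' i j"
        using one_lt[of i' j] by (auto simp: one zero)
      then have "j < w"
        by (rule zero_lt)
      then show "\<not> has_one ?T i j'"
        using \<open>?R\<close>[rule_format, of i j i' j'] * \<open>has_zero ?T' i j\<close> by (simp add: one)
    qed
  qed
  have sorted: "sorted_wrt (\<ge>) (map length ?rs) \<longleftrightarrow> sorted_wrt (\<ge>) (map length ?rs')"
    using xs x ys by (auto simp: sorted_wrt_append sorted_wrt_map le_SucI)
  show ?thesis
    unfolding is_catalan_Tableau columns zeros sorted using xs x ys by (auto simp: le_SucI)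
qed

text \<open>
  Row lengths decrease from bottom to top, so the rows of full width come first. Their number is the
  length of the initial run of North steps of the border, hence the position of the tail.
\<close>

lemma is_catalan_full_rows:
  assumes "is_catalan (Tableau w rs)"
  obtains xs ys where "rs = xs @ ys" "\<forall>x\<in>set xs. length x = w" "\<forall>y\<in>set ys. length y < w"
proof
  let ?P = "\<lambda>x. length x = w"
  show "rs = takeWhile ?P rs @ dropWhile ?P rs" by simp
  show "\<forall>x\<in>set (takeWhile ?P rs). length x = w"
    by (auto dest: set_takeWhileD)
  have sorted: "sorted_wrt (\<lambda>x y. length y \<le> length x) rs" and le: "\<forall>x\<in>set rs. length x \<le> w"
    using assms by (auto simp: is_catalan_Tableau sorted_wrt_map)
  show "\<forall>y\<in>set (dropWhile ?P rs). length y < w"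
  proof (cases "dropWhile ?P rs")
    case Nil
    show ?thesis
      unfolding Nil by simp
  next
    case (Cons z zs)
    then have "length z \<noteq> w"
      using hd_dropWhile[of ?P rs] by simp
    moreover have "z \<in> set rs"
      using Cons set_dropWhileD[of z ?P rs] by simp
    ultimately have "length z < w"
      using le by force
    moreover have "\<forall>y\<in>set zs. length y \<le> length z"
      using sorted takeWhile_dropWhile_id[of ?P rs] Cons
      by (metis sorted_wrt_append sorted_wrt.simps(2))
    ultimately show ?thesis
      unfolding Cons by auto
  qed
qed

text \<open>
  The two cases are the two possible values of the corner, which lies at the end of the last full row
  in \<open>us\<close>. A corner 0 has the 1 of its column below it, so its whole row is 0; a corner 1 is
  the only 1 of its column.
\<close>

lemma is_catalan_cases:
  assumes cat: "is_catalan (Tableau (Suc w) (us @ ys))"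
    and us: "\<forall>x\<in>set us. length x = Suc w" and ys: "\<forall>y\<in>set ys. length y < Suc w"
  obtains (zero) xs where "us = xs @ [replicate (Suc w) False]"
  | (one) xs x where "us = map (\<lambda>y. y @ [False]) xs @ [x @ [True]]"
      "\<forall>y\<in>set xs. length y = w" "length x = w"
proof -
  let ?T = "Tableau (Suc w) (us @ ys)"
  have "\<exists>!i. has_one ?T i w"
    using cat by (simp add: is_catalan_Tableau)
  then obtain i0 where i0: "has_one ?T i0 w" and uniq: "\<And>i. has_one ?T i w \<Longrightarrow> i = i0"
    by blast
  \<comment> \<open>Only the full rows reach the leftmost column, so a full row exists.\<close>
  have "i0 < length us"
  proof (rule ccontr)
    assume "\<not> i0 < length us"
    then have "(us @ ys) ! i0 \<in> set ys"
      using i0 by (auto simp: has_one_Tableau nth_append)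
    then show False
      using ys i0 by (auto simp: has_one_Tableau)
  qed
  then obtain vs z where vz: "us = vs @ [z]"
    by (metis append_butlast_last_id length_0_conv less_nat_zero_code)
  have z: "length z = Suc w"
    using us vz by simp
  show thesis
  proof (cases "z ! w")
    case True
    have "length vs = i0"
      using True z vz by (intro uniq) (simp add: has_one_Tableau nth_append)
    have vs: "v = take w v @ [False]" if v: "v \<in> set vs" for v
    proof -
      obtain i where i: "i < length vs" "v = vs ! i"
        using v by (metis in_set_conv_nth)
      have "length v = Suc w"
        using us vz v by simp
      moreover have "\<not> v ! w"
        using uniq[of i] i vz \<open>length vs = i0\<close> \<open>length v = Suc w\<close>
        by (auto simp: has_one_Tableau nth_append)
      ultimately show ?thesis
        by (metis (full_types) lessI take_Suc_conv_app_nth take_all_iff order_refl)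
    qed
    show thesis
    proof (rule one)
      have "vs = map (\<lambda>y. y @ [False]) (map (take w) vs)"
        using vs by (simp add: map_idI)
      moreover have "z = take w z @ [True]"
        using z True by (metis (full_types) lessI take_Suc_conv_app_nth take_all_iff order_refl)
      ultimately show "us = map (\<lambda>y. y @ [False]) (map (take w) vs) @ [take w z @ [True]]"
        using vz by simp
    qed (use us vz in auto)
  next
    case False
    have "i0 \<noteq> length vs"
      using i0 False vz by (auto simp: has_one_Tableau nth_append)
    then have "i0 < length vs"
      using \<open>i0 < length us\<close> vz by simp
    have "has_zero ?T (length vs) w"
      using False vz z by (simp add: has_zero_Tableau nth_append)
    then have "\<not> has_one ?T (length vs) j" if "j < w" for j
      using that cat i0 \<open>i0 < length vs\<close> by (auto simp: is_catalan_Tableau)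
    then have "\<not> z ! j" if "j < Suc w" for j
      using that False vz z by (auto simp: has_one_Tableau nth_append less_Suc_eq)
    then have "z = replicate (Suc w) False"
      using z by (intro nth_equalityI) (auto simp del: replicate_Suc)
    then show thesis
      using zero vz by simp
  qed
qed

section \<open>The border\<close>

lemma border_word_full_rows:
  "\<forall>x\<in>set xs. length x = w \<Longrightarrow>
   border_word w (map length (xs @ ys)) = replicate (length xs) North @ border_word w (map length ys)"
  by (induction xs) auto

lemma border_word_Suc:
  "\<forall>y\<in>set ys. length y \<le> w \<Longrightarrow>
   border_word (Suc w) (map length ys) = East # border_word w (map length ys)"
  by (cases ys) (auto simp: Suc_diff_le)

lemma length_border_word:
  "sorted_wrt (\<ge>) ls \<Longrightarrow> \<forall>l\<in>set ls. l \<le> w \<Longrightarrow> length (border_word w ls) = w + length ls"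
  by (induction w ls rule: border_word.induct) auto

text \<open>
  When no row has full width, the border cannot begin with a North step; so such a border serves as
  a tail, and it is empty exactly when there is no column left.
\<close>

lemma border_word_short_rows:
  assumes "\<forall>y\<in>set ys. length y < w"
  shows "takeWhile (\<lambda>s. s = North) (border_word w (map length ys)) = []"
    and "dropWhile (\<lambda>s. s = North) (border_word w (map length ys)) = border_word w (map length ys)"
    and "border_word w (map length ys) = [] \<longleftrightarrow> w = 0"
proof -
  have "border_word w (map length ys) = [] \<and> w = 0 \<or>
      w \<noteq> 0 \<and> (\<exists>v. border_word w (map length ys) = East # v)"
  proof (cases w)
    case 0
    then show ?thesis
      using assms by (cases ys) auto
  next
    case (Suc w')
    then show ?thesis
      using assms border_word_Suc[of ys w'] by (auto simp: less_Suc_eq_le)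
  qed
  then show "takeWhile (\<lambda>s. s = North) (border_word w (map length ys)) = []"
    "dropWhile (\<lambda>s. s = North) (border_word w (map length ys)) = border_word w (map length ys)"
    "border_word w (map length ys) = [] \<longleftrightarrow> w = 0"
    by auto
qed

section \<open>Binary trees along their right branch\<close>

text \<open>
  The tree whose right branch carries the given left subtrees, from the root down. Every binary tree
  has exactly one such representation, and in it the surgery of the algorithm becomes list
  surgery: the subtree at position \<open>r\<close> corresponds to the suffix that remains after dropping the first
  \<open>r\<close> entries.
\<close>

fun spine :: "btree list \<Rightarrow> btree" where
  "spine [] = Leaf"
| "spine (L # Ls) = Node L () (spine Ls)"

lemma spine_eq_iff [simp]: "spine Ls = spine Ls' \<longleftrightarrow> Ls = Ls'"
proof (induction Ls arbitrary: Ls')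
  case Nil
  then show ?case by (cases Ls') auto
next
  case (Cons L Ls)
  then show ?case by (cases Ls') auto
qed

lemma spine_eq_Leaf_iff [simp]: "spine Ls = Leaf \<longleftrightarrow> Ls = []"
  by (cases Ls) auto

lemma spine_cases: obtains Ls where "B = spine Ls"
proof -
  have "\<exists>Ls. B = spine Ls"
  proof (induction B)
    case Leaf
    show ?case by (rule exI[of _ "[]"]) simp
  next
    case (Node L x R)
    then obtain Ls where "R = spine Ls" by blast
    then show ?case by (intro exI[of _ "L # Ls"]) simp
  qed
  then show thesis using that by blast
qed

lemma right_chain_eq_spine: "right_chain q = spine (replicate q Leaf)"
  by (induction q) auto

lemma size_spine: "size (spine Ls) = sum_list (map size Ls) + length Ls"
  by (induction Ls) auto

lemma map_right_subtree_spine: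
  "f (spine Bs) = spine Cs \<Longrightarrow>
   map_right_subtree (length As) f (spine (As @ Bs)) = spine (As @ Cs)"
  by (induction As) auto

text \<open>
  This makes the grafting step reversible: the grafted vertex is recovered as the last one on the right
  branch whose left subtree is non-empty.
\<close>

lemma last_non_Leaf_unique:
  assumes "As @ L # replicate q Leaf = As' @ L' # replicate q' Leaf" "L \<noteq> Leaf" "L' \<noteq> Leaf"
  shows "As = As' \<and> L = L' \<and> q = q'"
proof -
  have rev: "replicate q Leaf @ L # rev As = replicate q' Leaf @ L' # rev As'"
    using arg_cong[OF assms(1), of rev] by simp
  have q: "length (takeWhile (\<lambda>t. t = Leaf) (replicate k Leaf @ M # Cs)) = k" if "M \<noteq> Leaf"
    for k and M :: "'a tree" and Cs
    using that by (subst takeWhile_append2) auto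
  have "q = q'"
    using q[OF assms(2), of q "rev As"] q[OF assms(3), of q' "rev As'"] rev by simp
  then show ?thesis
    using rev by simp
qed

lemma last_non_Leaf_cases:
  assumes "Ls \<noteq> replicate (length Ls) Leaf"
  obtains As L q where "Ls = As @ L # replicate q Leaf" "L \<noteq> Leaf"
proof -
  have "\<exists>L\<in>set Ls. L \<noteq> Leaf"
    using assms by (metis replicate_eqI)
  then obtain As L Cs where "Ls = As @ L # Cs" "L \<noteq> Leaf" "\<forall>C\<in>set Cs. \<not> C \<noteq> Leaf"
    using split_list_last_prop[of Ls "\<lambda>L. L \<noteq> Leaf"] by auto
  moreover from this have "Cs = replicate (length Cs) Leaf"
    by (intro replicate_eqI) auto
  ultimately show thesis
    using that by metis
qed

section \<open>One step of the algorithm\<close>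

lemma corner_row_eq:
  assumes "\<forall>x\<in>set xs. length x = Suc w" "length x = Suc w" "\<forall>y\<in>set ys. length y \<le> w"
  shows "corner_row (Tableau (Suc w) (xs @ x # ys)) = length xs"
proof -
  have "i \<le> length xs" if "i < length (xs @ x # ys)" "w < length ((xs @ x # ys) ! i)" for i
  proof (rule ccontr)
    assume "\<not> i \<le> length xs"
    then have "(xs @ x # ys) ! i \<in> set ys"
      using that(1) by (auto simp: nth_append nth_Cons')
    then show False
      using that(2) assms(3) by auto
  qed
  then have "{i. (i, w) \<in> cells (Tableau (Suc w) (xs @ x # ys))} = {..length xs}"
    using assms(1,2) by (auto simp: cells_def nth_append le_less)
  then have "corner_row (Tableau (Suc w) (xs @ x # ys)) = Max {..length xs}"
    by (simp add: corner_row_def)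
  also have "\<dots> = length xs"
    by (intro Max_eqI) auto
  finally show ?thesis .
qed

lemma phi_step_zero:
  assumes "\<forall>x\<in>set xs. length x = Suc w" "\<forall>y\<in>set ys. length y \<le> w"
  shows "phi_step (Tableau (Suc w) (xs @ replicate (Suc w) False # ys), B, v, Suc (length xs)) =
    (Tableau (Suc w) (xs @ ys), B, v, length xs)"
proof -
  have "corner_row (Tableau (Suc w) (xs @ replicate (Suc w) False # ys)) = length xs"
    using assms by (intro corner_row_eq) auto
  then show ?thesis
    by (simp add: corner_is_one_def has_one_Tableau delete_row_def nth_append
        del: replicate_Suc)
qed

text \<open>
  The rows \<open>zs\<close>, one cell shorter than the full rows, become full when the column is deleted; they are
  the North steps that leave the tail and turn into new vertices of the right branch.
\<close>

lemma phi_step_one: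
  assumes "\<forall>y\<in>set xs. length y = w" "length x = w"
    and zs: "\<forall>z\<in>set zs. length z = w" and ys: "\<forall>y\<in>set ys. length y < w"
    and "length As = length xs"
  shows "phi_step (Tableau (Suc w) (map (\<lambda>y. y @ [False]) xs @ (x @ [True]) # zs @ ys),
      spine (Leaf # As @ Bs), border_word (Suc w) (map length (zs @ ys)), Suc (length xs)) =
    (Tableau w (xs @ x # zs @ ys), spine (Leaf # As @ spine Bs # replicate (length zs) Leaf),
      border_word w (map length ys), Suc (length xs) + length zs)"
proof -
  let ?T = "Tableau (Suc w) (map (\<lambda>y. y @ [False]) xs @ (x @ [True]) # zs @ ys)"
  let ?v = "replicate (length zs) North @ border_word w (map length ys)"
  have "corner_row ?T = length (map (\<lambda>y. y @ [False]) xs)"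
    using assms by (intro corner_row_eq) auto
  then have "corner_is_one ?T"
    using assms(2) by (simp add: corner_is_one_def has_one_Tableau nth_append)
  moreover have "map (take w) xs = xs"
    using assms(1) by (simp add: map_idI)
  then have "delete_leftmost_column ?T = Tableau w (xs @ x # zs @ ys)"
    using assms(1,2) zs ys
    by (auto simp: delete_leftmost_column_def intro!: map_idI)
  moreover have "\<forall>y\<in>set (zs @ ys). length y \<le> w"
    using zs ys by auto
  then have "border_word (Suc w) (map length (zs @ ys)) = East # ?v"
    using border_word_Suc border_word_full_rows[OF zs, of ys] by metis
  moreover have "takeWhile (\<lambda>s. s = North) ?v = replicate (length zs) North"
    using border_word_short_rows(1)[OF ys] by (subst takeWhile_append2) auto
  moreover have "dropWhile (\<lambda>s. s = North) ?v = border_word w (map length ys)"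
    using border_word_short_rows(2)[OF ys] by (subst dropWhile_append2) auto
  moreover have "map_right_subtree (length (Leaf # As))
      (\<lambda>S. Node S () (right_chain (length zs))) (spine ((Leaf # As) @ Bs)) =
      spine ((Leaf # As) @ spine Bs # replicate (length zs) Leaf)"
    by (rule map_right_subtree_spine) (simp add: right_chain_eq_spine)
  ultimately show ?thesis
    using assms(5) by (simp add: Let_def)
qed

section \<open>The states of the algorithm\<close>

text \<open>
  A configuration is determined by the full rows \<open>xs\<close>, the shorter rows \<open>ys\<close> and the tree: the
  tail is the border above the full rows, attached at position \<open>length xs\<close>. The root of the tree is
  kept apart from \<open>Ls\<close> because its left subtree stays empty throughout.
\<close>

definition run_state :: "nat \<Rightarrow> bool list list \<Rightarrow> bool list list \<Rightarrow> btree list \<Rightarrow> state" where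
  "run_state w xs ys Ls =
     (Tableau w (xs @ ys), spine (Leaf # Ls), border_word w (map length ys), length xs)"

text \<open>
  The vertex carrying the tail has to exist, which gives \<open>length xs \<le> length Ls\<close>. Equality for width 0
  holds because a run ends right after the deletion of a column, or before its first step if there are
  no columns, and the tail is then attached to the last vertex; without it, some final configurations
  would not be reachable. The last condition expresses that vertices and remaining border steps add up to a constant.
\<close>

definition valid_run :: "nat \<Rightarrow> nat \<Rightarrow> bool list list \<Rightarrow> bool list list \<Rightarrow> btree list \<Rightarrow> bool" where
  "valid_run n w xs ys Ls \<longleftrightarrow>
     is_catalan (Tableau w (xs @ ys)) \<and>
     (\<forall>x\<in>set xs. length x = w) \<and> (\<forall>y\<in>set ys. length y < w) \<and>
     length xs \<le> length Ls \<and> (w = 0 \<longrightarrow> length xs = length Ls) \<and>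
     size (spine Ls) + length (border_word w (map length ys)) = n"

definition run_states :: "nat \<Rightarrow> state set" where
  "run_states n = {run_state w xs ys Ls | w xs ys Ls. valid_run n w xs ys Ls}"

definition running :: "state \<Rightarrow> bool" where
  "running = (\<lambda>(T, B, v, r). v \<noteq> [])"

text \<open>
  Initial trees are recognised by their shape: a right chain whose last vertex carries the tail.
\<close>

definition started :: "state \<Rightarrow> bool" where
  "started = (\<lambda>(T, B, v, r). B \<noteq> right_chain (Suc r))"

lemma running_run_state:
  "valid_run n w xs ys Ls \<Longrightarrow> running (run_state w xs ys Ls) \<longleftrightarrow> w \<noteq> 0"
  using border_word_short_rows(3)[of ys w] by (simp add: running_def run_state_def valid_run_def)

lemma started_run_state:
  "started (run_state w xs ys Ls) \<longleftrightarrow> Ls \<noteq> replicate (length xs) Leaf"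
  by (simp add: started_def run_state_def right_chain_eq_spine)

text \<open>
  Restoring a deleted zero row moves the tail one vertex down, which is possible exactly if it is
  not attached to the last vertex already.
\<close>

lemma valid_run_zero_iff:
  assumes "\<forall>x\<in>set xs. length x = Suc w" "\<forall>y\<in>set ys. length y < Suc w"
  shows "valid_run n (Suc w) (xs @ [replicate (Suc w) False]) ys Ls \<longleftrightarrow>
    valid_run n (Suc w) xs ys Ls \<and> length xs < length Ls"
proof -
  have "is_catalan (Tableau (Suc w) (xs @ replicate (Suc w) False # ys)) \<longleftrightarrow>
      is_catalan (Tableau (Suc w) (xs @ ys))"
    using assms by (intro is_catalan_insert_zero_row) auto
  then show ?thesis
    using assms by (auto simp: valid_run_def simp del: replicate_Suc)
qed

text \<open>
  Deleting the column removes one East step and \<open>length zs\<close> North steps from the tail, and the tree gains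
  the grafted vertex and a chain of \<open>length zs\<close> vertices. The list \<open>Bs\<close> is non-empty because it begins with the vertex carrying the tail.
\<close>

lemma valid_run_one_iff:
  assumes "\<forall>y\<in>set xs. length y = w" "length x = w" "\<forall>z\<in>set zs. length z = w"
    "\<forall>y\<in>set ys. length y < w" "length As = length xs" "Bs \<noteq> []"
  shows "valid_run n (Suc w) (map (\<lambda>y. y @ [False]) xs @ [x @ [True]]) (zs @ ys) (As @ Bs) \<longleftrightarrow>
    valid_run n w (xs @ x # zs) ys (As @ spine Bs # replicate (length zs) Leaf)"
proof -
  have "is_catalan (Tableau (Suc w) (map (\<lambda>y. y @ [False]) xs @ (x @ [True]) # zs @ ys)) \<longleftrightarrow>
      is_catalan (Tableau w (xs @ x # zs @ ys))"
    using assms by (intro is_catalan_insert_column) auto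
  moreover have "\<forall>y\<in>set (zs @ ys). length y \<le> w"
    using assms by auto
  then have "border_word (Suc w) (map length (zs @ ys)) =
      East # replicate (length zs) North @ border_word w (map length ys)"
    using border_word_Suc border_word_full_rows[OF assms(3), of ys] by metis
  moreover have "Suc 0 \<le> length Bs"
    using assms by (cases Bs) auto
  ultimately show ?thesis
    using assms by (auto simp: valid_run_def size_spine sum_list_replicate)
qed

text \<open>
  The two kinds of steps in a normal form from which both the old and the new configuration can be read
  off. In the second case the tail is attached to the last vertex afterwards; in the first it is
  not, so the two kinds cannot be confused.
\<close>

lemma running_state_cases:
  assumes "s \<in> run_states n" "running s"
  obtains (zero) w xs ys Ls where
      "s = run_state (Suc w) (xs @ [replicate (Suc w) False]) ys Ls"
      "phi_step s = run_state (Suc w) xs ys Ls"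
      "valid_run n (Suc w) xs ys Ls" "length xs < length Ls"
  | (one) w xs x zs ys As Bs where
      "s = run_state (Suc w) (map (\<lambda>y. y @ [False]) xs @ [x @ [True]]) (zs @ ys) (As @ Bs)"
      "phi_step s = run_state w (xs @ x # zs) ys (As @ spine Bs # replicate (length zs) Leaf)"
      "valid_run n w (xs @ x # zs) ys (As @ spine Bs # replicate (length zs) Leaf)"
      "length As = length xs" "Bs \<noteq> []"
proof -
  obtain w' us ys Ls where s: "s = run_state w' us ys Ls" and v: "valid_run n w' us ys Ls"
    using assms(1) by (auto simp: run_states_def)
  then obtain w where w: "w' = Suc w"
    using running_run_state[OF v] assms(2) by (cases w') auto
  have us: "\<forall>x\<in>set us. length x = Suc w" and ys: "\<forall>y\<in>set ys. length y < Suc w"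
    and cat: "is_catalan (Tableau (Suc w) (us @ ys))" and le: "length us \<le> length Ls"
    using v w by (auto simp: valid_run_def)
  from cat us ys show thesis
  proof (cases rule: is_catalan_cases)
    case (zero xs)
    have xs: "\<forall>x\<in>set xs. length x = Suc w"
      using us zero by auto
    show thesis
    proof (rule that(1))
      show "s = run_state (Suc w) (xs @ [replicate (Suc w) False]) ys Ls"
        using s w zero by simp
      then show "phi_step s = run_state (Suc w) xs ys Ls"
        using phi_step_zero[of xs w ys] xs ys
        by (simp add: run_state_def less_Suc_eq_le del: replicate_Suc phi_step.simps)
      show "valid_run n (Suc w) xs ys Ls" "length xs < length Ls"
        using valid_run_zero_iff[OF xs ys, of n Ls] v w zero by auto
    qed
  next
    case (one xs x)
    have "\<forall>y\<in>set ys. length y \<le> w"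
      using ys by auto
    then have "is_catalan (Tableau w (xs @ x # ys))"
      using is_catalan_insert_column[of xs w x ys] one cat by simp
    then obtain us' ys' where split: "xs @ x # ys = us' @ ys'" "\<forall>x\<in>set us'. length x = w"
        "\<forall>y\<in>set ys'. length y < w"
      by (rule is_catalan_full_rows)
    \<comment> \<open>The row of the deleted corner is still full, so it belongs to the full rows of the new tableau.\<close>
    have "length xs < length us'"
    proof (rule ccontr)
      assume "\<not> length xs < length us'"
      then have "x \<in> set ys'"
        using arg_cong[OF split(1), of "\<lambda>rs. rs ! length xs"]
        using arg_cong[OF split(1), of length]
        by (auto simp: nth_append)
      then show False
        using split(3) one by auto
    qed
    then obtain zs where zs: "us' = xs @ x # zs" "ys = zs @ ys'"
      using split(1) by (auto simp: append_eq_append_conv2 append_eq_Cons_conv Cons_eq_append_conv)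
    define As Bs where "As = take (length xs) Ls" and "Bs = drop (length xs) Ls"
    have AB: "Ls = As @ Bs" "length As = length xs" "Bs \<noteq> []"
      using le one by (auto simp: As_def Bs_def)
    have zs_len: "\<forall>z\<in>set zs. length z = w"
      using split(2) zs by auto
    show thesis
    proof (rule that(2))
      show s': "s = run_state (Suc w) (map (\<lambda>y. y @ [False]) xs @ [x @ [True]]) (zs @ ys') (As @ Bs)"
        using s w one zs AB by simp
      show "phi_step s = run_state w (xs @ x # zs) ys' (As @ spine Bs # replicate (length zs) Leaf)"
        using phi_step_one[OF one(2,3) zs_len split(3) AB(2), of Bs] unfolding s'
        by (simp add: run_state_def del: phi_step.simps)
      show "valid_run n w (xs @ x # zs) ys' (As @ spine Bs # replicate (length zs) Leaf)"
        using valid_run_one_iff[OF one(2,3) zs_len split(3) AB(2,3), of n] v w one(1) zs AB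
        by simp
    qed (use AB in auto)
  qed
qed

lemma run_state_eq_iff:
  "run_state w xs ys Ls = run_state w' xs' ys' Ls' \<longleftrightarrow>
   w = w' \<and> xs = xs' \<and> ys = ys' \<and> Ls = Ls'"
  by (auto simp: run_state_def)

text \<open>
  Injectivity compares the normal forms of two steps with the same result. For surjectivity, the
  position of the tail decides which step to undo: if it is not attached to the last vertex, a zero
  row was deleted; otherwise a column was, and its height is the position on the right branch of the last
  non-empty left subtree.
\<close>

lemma bij_betw_phi_step:
  "bij_betw phi_step {s \<in> run_states n. running s} {s \<in> run_states n. started s}"
  unfolding bij_betw_def
proof (intro conjI inj_onI equalityI subsetI)
  fix s t
  assume s: "s \<in> {s \<in> run_states n. running s}" and t: "t \<in> {s \<in> run_states n. running s}"
    and eq: "phi_step s = phi_step t"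
  from s have "s \<in> run_states n" "running s" by auto
  then show "s = t"
  proof (cases rule: running_state_cases)
    case s: (zero w xs ys Ls)
    from t have "t \<in> run_states n" "running t" by auto
    then show ?thesis
    proof (cases rule: running_state_cases)
      case t: (zero w' xs' ys' Ls')
      have "run_state (Suc w) xs ys Ls = run_state (Suc w') xs' ys' Ls'"
        using s t eq by simp
      then show ?thesis
        unfolding run_state_eq_iff using s t by auto
    next
      case t: (one w' xs' x' zs' ys' As' Bs')
      have "run_state (Suc w) xs ys Ls =
          run_state w' (xs' @ x' # zs') ys' (As' @ spine Bs' # replicate (length zs') Leaf)"
        using s t eq by simp
      then show ?thesis
        unfolding run_state_eq_iff using s t by auto
    qed
  next
    case s: (one w xs x zs ys As Bs)
    from t have "t \<in> run_states n" "running t" by auto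
    then show ?thesis
    proof (cases rule: running_state_cases)
      case t: (zero w' xs' ys' Ls')
      have "run_state w (xs @ x # zs) ys (As @ spine Bs # replicate (length zs) Leaf) =
          run_state (Suc w') xs' ys' Ls'"
        using s t eq by simp
      then show ?thesis
        unfolding run_state_eq_iff using s t by auto
    next
      case t: (one w' xs' x' zs' ys' As' Bs')
      have "run_state w (xs @ x # zs) ys (As @ spine Bs # replicate (length zs) Leaf) =
          run_state w' (xs' @ x' # zs') ys' (As' @ spine Bs' # replicate (length zs') Leaf)"
        using s t eq by simp
      then have *: "w = w'" "xs @ x # zs = xs' @ x' # zs'" "ys = ys'"
        "As @ spine Bs # replicate (length zs) Leaf = As' @ spine Bs' # replicate (length zs') Leaf"
        unfolding run_state_eq_iff by auto
      then have AB: "As = As'" "Bs = Bs'"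
        using last_non_Leaf_unique[OF *(4)] s(5) t(5) by auto
      then have "xs = xs'" "x = x'" "zs = zs'"
        using *(2) s(4) t(4) by (auto simp: append_eq_append_conv)
      then show ?thesis
        using s(1) t(1) * AB by simp
    qed
  qed
next
  fix t
  assume "t \<in> phi_step ` {s \<in> run_states n. running s}"
  then obtain s where t: "t = phi_step s" and "s \<in> run_states n" "running s"
    by auto
  from this(2,3) show "t \<in> {s \<in> run_states n. started s}"
  proof (cases rule: running_state_cases)
    case (zero w xs ys Ls)
    then show ?thesis
      unfolding t by (auto simp: run_states_def started_run_state)
  next
    case (one w xs x zs ys As Bs)
    have "As @ spine Bs # replicate (length zs) Leaf \<noteq> replicate k Leaf" for k
    proof
      assume "As @ spine Bs # replicate (length zs) Leaf = replicate k Leaf"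
      then have "spine Bs \<in> set (replicate k Leaf)"
        by (metis in_set_conv_decomp)
      then show False
        using one(5) by simp
    qed
    then have "started (phi_step s)"
      unfolding one(2) started_run_state .
    then show ?thesis
      using one unfolding t run_states_def by auto
  qed
next
  fix t
  assume "t \<in> {s \<in> run_states n. started s}"
  then obtain w us ys Ls where t: "t = run_state w us ys Ls" and v: "valid_run n w us ys Ls"
    and neq: "Ls \<noteq> replicate (length us) Leaf"
    by (auto simp: run_states_def started_run_state)
  have us: "\<forall>x\<in>set us. length x = w" and ys: "\<forall>y\<in>set ys. length y < w"
    and le: "length us \<le> length Ls"
    using v by (auto simp: valid_run_def)
  show "t \<in> phi_step ` {s \<in> run_states n. running s}"
  proof (cases "length us = length Ls")
    case False
    \<comment> \<open>The width is positive, since at width 0 the tail is attached to the last vertex.\<close>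
    then obtain w' where w: "w = Suc w'"
      using v by (cases w) (auto simp: valid_run_def)
    let ?s = "run_state w (us @ [replicate w False]) ys Ls"
    have "valid_run n w (us @ [replicate w False]) ys Ls"
      using valid_run_zero_iff[of us w' ys n Ls] us ys v False le w by simp
    then have "?s \<in> run_states n" "running ?s"
      using w running_run_state[of n w] by (auto simp: run_states_def)
    moreover have "phi_step ?s = t"
      using phi_step_zero[of us w' ys] us ys w t
      by (simp add: run_state_def less_Suc_eq_le del: replicate_Suc phi_step.simps)
    ultimately show ?thesis
      by blast
  next
    case True
    then obtain As L q where L: "Ls = As @ L # replicate q Leaf" "L \<noteq> Leaf"
      using neq last_non_Leaf_cases by metis
    obtain Bs where Bs: "L = spine Bs"
      by (rule spine_cases)
    \<comment> \<open>The grafted vertex is at position \<open>Suc (length As)\<close>, because the root is not in the list; so this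
      is the height of the deleted column, and row \<open>length As\<close>, counted from 0, contained the corner.\<close>
    define xs x zs where "xs = take (length As) us" and "x = us ! length As"
      and "zs = drop (Suc (length As)) us"
    have lt: "length As < length us"
      using True L by simp
    have split: "us = xs @ x # zs"
      using lt by (simp add: xs_def x_def zs_def id_take_nth_drop)
    have q: "length zs = q" "length As = length xs"
      using True L lt by (auto simp: xs_def zs_def)
    have lens: "\<forall>y\<in>set xs. length y = w" "length x = w" "\<forall>z\<in>set zs. length z = w"
      using us split by auto
    have "Bs \<noteq> []"
      using L Bs by auto
    let ?us = "map (\<lambda>y. y @ [False]) xs @ [x @ [True]]"
    let ?s = "run_state (Suc w) ?us (zs @ ys) (As @ Bs)"
    have "valid_run n (Suc w) ?us (zs @ ys) (As @ Bs)"
      using valid_run_one_iff[OF lens ys q(2) \<open>Bs \<noteq> []\<close>, of n] v split L Bs q by simp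
    then have "?s \<in> run_states n" "running ?s"
      using running_run_state[of n "Suc w"] by (auto simp: run_states_def)
    moreover have "phi_step ?s = t"
      using phi_step_one[OF lens ys q(2), of Bs] t split L Bs q
      by (simp add: run_state_def del: phi_step.simps)
    ultimately show ?thesis
      by blast
  qed
qed

text \<open>
  The index of the current tableau is the measure of the loop. Every step deletes a row or a column, and by
  this equation the index never exceeds \<open>n\<close>, since the right branch has more than \<open>length xs\<close> vertices.
\<close>

lemma tableau_index_run_state:
  assumes "valid_run n w xs ys Ls"
  shows "tableau_index (fst (run_state w xs ys Ls)) + size (spine Ls) = n + length xs"
proof -
  have "sorted_wrt (\<ge>) (map length ys)" "\<forall>l\<in>set (map length ys). l \<le> w"
    using assms by (auto simp: valid_run_def is_catalan_Tableau sorted_wrt_append)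
  then show ?thesis
    using assms length_border_word[of "map length ys" w]
    by (simp add: valid_run_def run_state_def tableau_index_def)
qed

lemma bij_betw_while_phi_step:
  "bij_betw (while running phi_step) {s \<in> run_states n. \<not> started s} {s \<in> run_states n. \<not> running s}"
proof (rule while_bij_betw[OF bij_betw_phi_step])
  fix s
  assume "s \<in> run_states n"
  then show "tableau_index (fst s) \<le> n"
    using tableau_index_run_state by (fastforce simp: run_states_def valid_run_def size_spine)
  assume "running s"
  with \<open>s \<in> run_states n\<close> show "tableau_index (fst (phi_step s)) < tableau_index (fst s)"
    by (cases rule: running_state_cases) (auto simp: run_state_def tableau_index_def)
qed

section \<open>From initial states to final trees\<close>

lemma phi_init_Tableau:
  assumes xs: "\<forall>x\<in>set xs. length x = w" and ys: "\<forall>y\<in>set ys. length y < w"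
  shows "phi_init (Tableau w (xs @ ys)) = run_state w xs ys (replicate (length xs) Leaf)"
proof -
  let ?v = "replicate (length xs) North @ border_word w (map length ys)"
  have "nw_border (Tableau w (xs @ ys)) = ?v"
    using border_word_full_rows[OF xs, of ys] by (simp add: nw_border_def shape_def)
  moreover have "takeWhile (\<lambda>s. s = North) ?v = replicate (length xs) North"
    using border_word_short_rows(1)[OF ys] by (subst takeWhile_append2) auto
  moreover have "dropWhile (\<lambda>s. s = North) ?v = border_word w (map length ys)"
    using border_word_short_rows(2)[OF ys] by (subst dropWhile_append2) auto
  ultimately show ?thesis
    by (simp add: phi_init_def run_state_def right_chain_eq_spine Let_def)
qed

lemma valid_run_init_iff:
  assumes "\<forall>x\<in>set xs. length x = w" "\<forall>y\<in>set ys. length y < w"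
  shows "valid_run n w xs ys (replicate (length xs) Leaf) \<longleftrightarrow>
    Tableau w (xs @ ys) \<in> catalan_tableaux n"
proof -
  have "length (border_word w (map length ys)) = w + length ys"
    if "is_catalan (Tableau w (xs @ ys))"
    using that length_border_word[of "map length ys" w] assms(2)
    by (auto simp: is_catalan_Tableau sorted_wrt_append)
  then show ?thesis
    using assms
    by (auto simp: valid_run_def mem_catalan_tableaux_iff tableau_index_def size_spine
        sum_list_replicate)
qed

lemma bij_betw_phi_init:
  "bij_betw phi_init (catalan_tableaux n) {s \<in> run_states n. \<not> started s}"
  unfolding bij_betw_def
proof (intro conjI inj_onI equalityI subsetI)
  show "T = T'" if "phi_init T = phi_init T'" for T T'
    using that by (simp add: phi_init_def Let_def)
next
  fix s
  assume "s \<in> phi_init ` catalan_tableaux n"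
  then obtain w rs where s: "s = phi_init (Tableau w rs)" and T: "Tableau w rs \<in> catalan_tableaux n"
    by (metis imageE tableau.exhaust)
  from T have "is_catalan (Tableau w rs)"
    by (simp add: mem_catalan_tableaux_iff)
  then obtain xs ys where *: "rs = xs @ ys" "\<forall>x\<in>set xs. length x = w" "\<forall>y\<in>set ys. length y < w"
    by (rule is_catalan_full_rows)
  then have "valid_run n w xs ys (replicate (length xs) Leaf)"
    using valid_run_init_iff[OF *(2,3)] T by simp
  then show "s \<in> {s \<in> run_states n. \<not> started s}"
    unfolding s *(1) phi_init_Tableau[OF *(2,3)] by (auto simp: run_states_def started_run_state)
next
  fix s
  assume "s \<in> {s \<in> run_states n. \<not> started s}"
  then obtain w xs ys where s: "s = run_state w xs ys (replicate (length xs) Leaf)"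
    and v: "valid_run n w xs ys (replicate (length xs) Leaf)"
    by (auto simp: run_states_def started_run_state)
  then have *: "\<forall>x\<in>set xs. length x = w" "\<forall>y\<in>set ys. length y < w"
    by (auto simp: valid_run_def)
  show "s \<in> phi_init ` catalan_tableaux n"
    using valid_run_init_iff[OF *] v phi_init_Tableau[OF *] s by (metis image_eqI)
qed

lemma valid_run_final_iff:
  "valid_run n 0 xs ys Ls \<longleftrightarrow> ys = [] \<and> xs = replicate (length Ls) [] \<and> size (spine Ls) = n"
proof -
  have "is_catalan (Tableau 0 (replicate k []))" for k
    by (auto simp: is_catalan_Tableau has_zero_Tableau sorted_wrt_iff_nth_less)
  moreover have "xs = replicate (length xs) []" if "\<forall>x\<in>set xs. x = []"
    using that by (intro replicate_eqI) auto
  ultimately have "is_catalan (Tableau 0 xs)" if "\<forall>x\<in>set xs. x = []"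
    using that by metis
  moreover have "xs = replicate k [] \<longleftrightarrow> length xs = k \<and> (\<forall>x\<in>set xs. x = [])" for k
    by (auto intro: replicate_eqI)
  ultimately show ?thesis
    by (cases ys) (auto simp: valid_run_def)
qed

text \<open>
  At the end there are no cells left, and the number of remaining empty rows is the position of the last
  vertex of the right branch; so the tree alone determines the final configuration.
\<close>

lemma bij_betw_final_tree:
  "bij_betw (\<lambda>(T, B, v, r). right B) {s \<in> run_states n. \<not> running s} {B :: btree. size B = n}"
proof -
  have "{s \<in> run_states n. \<not> running s} =
      (\<lambda>Ls. run_state 0 (replicate (length Ls) []) [] Ls) ` {Ls. size (spine Ls) = n}" (is "_ = ?f ` ?A")
  proof -
    have "s \<in> run_states n \<and> \<not> running s \<longleftrightarrow>
        (\<exists>xs ys Ls. s = run_state 0 xs ys Ls \<and> valid_run n 0 xs ys Ls)" for s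
    proof
      assume "s \<in> run_states n \<and> \<not> running s"
      then obtain w xs ys Ls where "s = run_state w xs ys Ls" "valid_run n w xs ys Ls" "\<not> running s"
        by (auto simp: run_states_def)
      then show "\<exists>xs ys Ls. s = run_state 0 xs ys Ls \<and> valid_run n 0 xs ys Ls"
        using running_run_state[of n w xs ys Ls] by auto
    next
      assume "\<exists>xs ys Ls. s = run_state 0 xs ys Ls \<and> valid_run n 0 xs ys Ls"
      then obtain xs ys Ls where "s = run_state 0 xs ys Ls" "valid_run n 0 xs ys Ls"
        by blast
      then show "s \<in> run_states n \<and> \<not> running s"
        using running_run_state[of n 0 xs ys Ls] by (auto simp: run_states_def)
    qed
    then show ?thesis
      by (auto simp: valid_run_final_iff)
  qed
  moreover have "bij_betw (\<lambda>(T, B, v, r). right B) (?f ` ?A) {B :: btree. size B = n}"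
  proof -
    have right: "(\<lambda>(T, B, v, r). right B) \<circ> ?f = spine"
      by (auto simp: run_state_def fun_eq_iff)
    have "spine ` ?A = {B :: btree. size B = n}"
    proof (intro equalityI subsetI)
      fix B :: btree
      assume "B \<in> {B. size B = n}"
      moreover obtain Ls where "B = spine Ls"
        by (rule spine_cases)
      ultimately show "B \<in> spine ` ?A"
        by simp
    qed auto
    moreover have "inj_on spine ?A"
      by (simp add: inj_on_def)
    ultimately show ?thesis
      unfolding bij_betw_def right[symmetric] by (simp add: inj_on_imageI image_comp)
  qed
  ultimately show ?thesis
    by simp
qed

text \<open>
  The special treatment of borders without East steps is consistent with the loop: there the tail is
  empty from the start, and removing the root of the initial chain gives the chain
  with one vertex for each row.
\<close>

lemma phi_eq_while:
  assumes "T \<in> catalan_tableaux n"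
  shows "phi T = (\<lambda>(T, B, v, r). right B) (while running phi_step (phi_init T))"
proof (cases "East \<in> set (nw_border T)")
  case True
  then show ?thesis
    by (simp add: phi_def running_def)
next
  case False
  obtain w rs where T: "T = Tableau w rs"
    by (cases T)
  from assms have "is_catalan (Tableau w rs)"
    by (simp add: mem_catalan_tableaux_iff T)
  then obtain xs ys where *: "rs = xs @ ys" "\<forall>x\<in>set xs. length x = w" "\<forall>y\<in>set ys. length y < w"
    by (rule is_catalan_full_rows)
  have "East \<notin> set (border_word w (map length ys))"
    using False border_word_full_rows[OF *(2), of ys] by (simp add: T *(1) nw_border_def shape_def)
  then have "w = 0"
    using border_word_Suc[of ys "w - 1"] *(3) by (cases w) (auto simp: less_Suc_eq_le)
  then have "ys = []"
    using *(3) by (cases ys) auto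
  have "phi T = right_chain (length xs)"
    using False \<open>w = 0\<close> \<open>ys = []\<close> by (simp add: phi_def T *(1) tableau_index_def)
  moreover have init: "phi_init T = run_state w xs ys (replicate (length xs) Leaf)"
    using phi_init_Tableau[OF *(2,3)] by (simp add: T *(1))
  moreover have "\<not> running (phi_init T)"
    unfolding init using \<open>w = 0\<close> \<open>ys = []\<close> by (simp add: running_def run_state_def)
  then have "while running phi_step (phi_init T) = phi_init T"
    by (subst while_unfold) simp
  ultimately show ?thesis
    by (simp add: run_state_def right_chain_eq_spine)
qed

theorem proposition2p3:
  fixes n :: nat
  assumes "n \<ge> 1"
  shows "bij_betw phi (catalan_tableaux n) {B :: btree. size B = n}"
proof -
  have "bij_betw ((\<lambda>(T, B, v, r). right B) \<circ> (while running phi_step \<circ> phi_init))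
      (catalan_tableaux n) {B :: btree. size B = n}"
    by (intro bij_betw_trans[OF _ bij_betw_final_tree]
        bij_betw_trans[OF bij_betw_phi_init bij_betw_while_phi_step])
  then show ?thesis
    by (rule bij_betw_cong[THEN iffD1, rotated]) (simp add: phi_eq_while)
qed

end
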